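(* Let $0<a\le 1$ and let $z\in\mathbb{C}$ with $0<|z|\le 1$. Let $\Phi(s,a,z)$ denote the Hurwitz-Lerch zeta function (analytically continued in $s$). (1) Let $z=1$. Then $\Phi(\sigma,a,1)\neq 0$ for all real $\sigma$ with $0<\sigma<1$ if and only if $a\ge 1/2$. (2) Let $z\neq 1$. Then $\Phi(\sigma,a,z)\neq 0$ for all real $\sigma$ with $0<\sigma<1$ and all $0<a\le 1$.
   Context: For $0<a\le 1$, $z\in\mathbb{C}$ with $0<|z|\le 1$, and $s=\sigma+it\in\mathbb{C}$ with $\sigma>1$, the Hurwitz-Lerch zeta function is $$\Phi(s,a,z):=\sum_{n=0}^\infty \frac{z^n}{(n+a)^s}.$$ For $z\ne 1$ it continues analytically in $s$ to all of $\mathbb{C}$. For $z=1$ it is the Hurwitz zeta function $\zeta(s,a):=\Phi(s,a,1)$, which continues meromorphically to $\mathbb{C}$ with only a simple pole at $s=1$. For $0<\sigma<1$, $\Phi(\sigma,a,z)$ denotes the value of this continuation. *)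

theory Defs
  imports "HOL-Complex_Analysis.Complex_Analysis"
begin

definition lerch_series :: "complex \<Rightarrow> real \<Rightarrow> complex \<Rightarrow> complex" where
  "lerch_series s a z = (\<Sum>n. z ^ n / complex_of_real (real n + a) powr s)"

definition lerch_domain :: "complex \<Rightarrow> complex set" where
  "lerch_domain z = (if z = 1 then UNIV - {1} else UNIV)"

definition lerch_continuation :: "(complex \<Rightarrow> complex) \<Rightarrow> real \<Rightarrow> complex \<Rightarrow> bool" where
  "lerch_continuation F a z \<longleftrightarrow>
     F holomorphic_on lerch_domain z \<and> (\<forall>s. Re s > 1 \<longrightarrow> F s = lerch_series s a z)"

(* The continuation is unique on lerch_domain z, see lerch_continuation_unique below. The value
   at the pole s = 1, z = 1 is arbitrary. *)
definition hurwitz_lerch :: "complex \<Rightarrow> real \<Rightarrow> complex \<Rightarrow> complex" where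
  "hurwitz_lerch s a z = (SOME F. lerch_continuation F a z) s"

lemma lerch_continuation_unique:
  assumes F: "lerch_continuation F a z" and G: "lerch_continuation G a z"
    and s: "s \<in> lerch_domain z"
  shows "F s = G s"
proof -
  let ?U = "{s::complex. Re s > 1}"
  have op: "open (lerch_domain z)"
    by (simp add: lerch_domain_def open_delete)
  have conn: "connected (lerch_domain z)"
    using connected_punctured_universe[of "1::complex"] connected_UNIV[where ?'a = complex]
    by (simp add: lerch_domain_def Compl_eq_Diff_UNIV)
  have U: "open ?U" by (rule open_halfspace_Re_gt)
  have sub: "?U \<subseteq> lerch_domain z" by (auto simp: lerch_domain_def)
  have "2 islimpt ?U"
    by (rule interior_limit_point) (simp add: interior_open[OF U])
  moreover have "(\<lambda>s. F s - G s) holomorphic_on lerch_domain z"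
    using F G by (auto simp: lerch_continuation_def intro!: holomorphic_intros)
  moreover have "F w - G w = 0" if "w \<in> ?U" for w
    using F G that by (simp add: lerch_continuation_def)
  moreover have "2 \<in> lerch_domain z" by (simp add: lerch_domain_def)
  ultimately have "F s - G s = 0"
    using analytic_continuation[of "\<lambda>s. F s - G s" "lerch_domain z" ?U 2 s] op conn sub s
    by blast
  then show ?thesis by simp
qed

end

theory Submission imports Defs begin

text \<open>
  Two ideas carry the proof: a recursion in \<open>s\<close> that produces the analytic continuation without any
  integral, and, on the real interval, a series for the continued function, multiplied by a factor
  without zeros there, whose sign can be read off.

  Continuation. Expanding \<open>(x + 1)\<^sup>-\<^sup>s\<close> in powers of \<open>1/x\<close> to order \<open>k\<close> leaves an error of size
  \<open>x\<close> to the power \<open>- Re s - k - 1\<close>. Put \<open>x = n + a\<close>, multiply by \<open>z\<^sup>n\<close> and sum over \<open>n\<close>. Shifting the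
  index relates the sum of the left-hand sides to \<open>\<Phi>(s)\<close> again, and the result is
  (\<open>lerch_series_shift_identity\<close>)
  \[ (1 - z)\,\Phi(s) = a^{-s} + z \sum_{j=1}^{k} {-s \choose j} \Phi(s + j) + z\, T_k(s), \]
  where the error series \<open>T\<^sub>k\<close> is holomorphic on \<open>Re s > - k\<close>. The right-hand side only involves
  \<open>\<Phi>\<close> at points further to the right, so \<open>\<Phi>\<close> extends one unit to the left at a time
  (\<open>shift_recursion_continuation\<close>). For \<open>z \<noteq> 1\<close> one divides by \<open>1 - z\<close>. For \<open>z = 1\<close> the
  left-hand side vanishes, the leading term becomes the one with \<open>j = 1\<close>, and the same recursion
  continues \<open>H(s) = (s - 1) \<zeta>(s, a)\<close> to an entire function.

  Case \<open>z \<noteq> 1\<close>. For real \<open>\<sigma> > 0\<close> and \<open>c\<^sub>n = (n + a)\<^sup>-\<^sup>\<sigma>\<close> the identity with \<open>k = 0\<close> is Abel summation and reads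
  \[ (1 - z)\,\Phi(\sigma) = \sum_{n \ge 0} (c_n - c_{n+1}) (1 - z^{n+1}). \]
  The \<open>c\<^sub>n\<close> decrease and \<open>|z| \<le> 1\<close>, so every term has nonnegative real part, and the first one
  has positive real part (\<open>Re_abel_sum_pos\<close>).

  Case \<open>z = 1\<close>. With \<open>p = 1 - \<sigma>\<close> and \<open>f(x) = x\<^sup>p\<close> one has
  \<open>H(\<sigma>) = f(a) + (\<Sum>n. f(n + a + 1) - f(n + a) - f'(n + a))\<close>. Since \<open>f'\<close> is strictly convex,
  \<open>f'(x) < f(x + 1/2) - f(x - 1/2)\<close>. This needs \<open>x \<ge> 1/2\<close>, which is where \<open>a \<ge> 1/2\<close> enters;
  replacing \<open>f'(n + a)\<close> by this difference makes the sum telescope and yields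
  \<open>H(\<sigma>) > f(a - 1/2) \<ge> 0\<close> (\<open>powr_plus_tangent_error_sum_pos\<close>). If \<open>a < 1/2\<close>, then
  \<open>H(0) = a - 1/2 < 0 < 1 = H(1)\<close>, so \<open>H\<close>, which is real on the interval, has a zero inside it.
\<close>

section \<open>The remainder of the binomial expansion\<close>

text \<open>
  The error of order \<open>k\<close> in the expansion of \<open>(x + 1)\<^sup>-\<^sup>s = x\<^sup>-\<^sup>s (1 + 1/x)\<^sup>-\<^sup>s\<close> in powers of \<open>1/x\<close>.
\<close>
definition binomial_remainder :: "nat \<Rightarrow> complex \<Rightarrow> real \<Rightarrow> complex" where
  "binomial_remainder k s x =
     of_real (x + 1) powr (-s) - (\<Sum>j\<le>k. ((-s) gchoose j) * of_real x powr (-s - of_nat j))"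

text \<open>
  The error series \<open>T\<^sub>k\<close> of the introduction.
\<close>
definition remainder_series :: "real \<Rightarrow> complex \<Rightarrow> nat \<Rightarrow> complex \<Rightarrow> complex" where
  "remainder_series a z k s = (\<Sum>n. z ^ n * binomial_remainder k s (real n + a))"

lemma norm_of_real_powr:
  assumes "0 < x"
  shows "norm (complex_of_real x powr s) = x powr Re s"
  using norm_powr_real_powr[of "of_real x" s] assms by simp

text \<open>
  The expansion is the Taylor polynomial of \<open>y \<mapsto> y\<^sup>-\<^sup>s\<close> at \<open>x\<close>, evaluated at distance 1, so the
  error is controlled by the derivative of order \<open>k + 1\<close> on the segment from \<open>x\<close> to \<open>x + 1\<close>. The
  condition on \<open>Re s\<close> makes the modulus of that derivative largest at the left end \<open>x\<close>.
\<close>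
lemma norm_binomial_remainder_le:
  assumes x: "0 < x" and s: "- real k - 1 \<le> Re s"
  shows "norm (binomial_remainder k s x)
           \<le> norm (\<Prod>j\<le>k. - s - of_nat j) / fact k * x powr (- Re s - real k - 1)"
proof -
  define S where "S = closed_segment (complex_of_real x) (of_real (x + 1))"
  \<comment> \<open>The derivative of order \<open>i\<close> of \<open>y \<mapsto> y\<^sup>-\<^sup>s\<close>.\<close>
  define f where "f i y = (\<Prod>j<i. - s - of_nat j) * y powr (- s - of_nat i)" for i and y :: complex
  let ?B = "norm (\<Prod>j\<le>k. - s - of_nat j) * x powr (- Re s - real k - 1)"
  have real: "\<exists>t. y = of_real t \<and> x \<le> t" if "y \<in> S" for y
  proof -
    have "y \<in> complex_of_real ` closed_segment x (x + 1)"
      using that by (simp only: S_def closed_segment_of_real)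
    then show ?thesis by (auto simp: closed_segment_eq_real_ivl)
  qed
  have "norm (f 0 (of_real (x + 1)) - (\<Sum>i\<le>k. f i (of_real x) * (of_real (x + 1) - of_real x) ^ i / fact i))
          \<le> ?B * norm (complex_of_real (x + 1) - of_real x) ^ Suc k / fact k"
  proof (rule field_Taylor[where f = f and S = S])
    show "convex S" by (simp add: S_def)
    show "complex_of_real x \<in> S" "complex_of_real (x + 1) \<in> S" by (simp_all add: S_def)
  next
    fix i y assume "y \<in> S"
    then obtain t where t: "y = of_real t" "x \<le> t" using real by blast
    then have "y \<notin> \<real>\<^sub>\<le>\<^sub>0" using x by auto
    then have "((\<lambda>y. y powr (- s - of_nat i)) has_field_derivative
                 (- s - of_nat i) * y powr (- s - of_nat i - 1)) (at y within S)"
      by (rule has_field_derivative_at_within[OF has_field_derivative_powr])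
    from DERIV_cmult[OF this, of "\<Prod>j<i. - s - of_nat j"]
    show "(f i has_field_derivative f (Suc i) y) (at y within S)"
      by (simp add: f_def[abs_def] algebra_simps)
  next
    fix y assume "y \<in> S"
    then obtain t where t: "y = of_real t" "x \<le> t" using real by blast
    have "t powr (- Re s - real k - 1) \<le> x powr (- Re s - real k - 1)"
      using t x s by (intro powr_mono2') auto
    then show "norm (f (Suc k) y) \<le> ?B"
      using t x
      by (auto simp: f_def norm_mult norm_of_real_powr lessThan_Suc_atMost algebra_simps
               intro!: mult_left_mono simp del: prod.lessThan_Suc prod.atMost_Suc)
  qed
  moreover have "f i (of_real x) * (of_real (x + 1) - of_real x) ^ i / fact i
                   = ((-s) gchoose i) * of_real x powr (-s - of_nat i)" for i
    by (simp add: f_def gbinomial_prod_rev atLeast0LessThan)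
  ultimately show ?thesis
    by (simp add: binomial_remainder_def f_def)
qed

section \<open>A shift identity for the Lerch series\<close>
lemma lerch_terms_summable:
  assumes a: "0 < a" and z: "norm z \<le> 1" and s: "1 < Re s"
  shows "summable (\<lambda>n. z ^ n * complex_of_real (real n + a) powr (-s))"
proof (rule summable_comparison_test_ev)
  show "summable (\<lambda>n. real n powr (- Re s))"
    using s by (simp add: summable_real_powr_iff)
  show "\<forall>\<^sub>F n in sequentially. norm (z ^ n * complex_of_real (real n + a) powr (-s)) \<le> real n powr (- Re s)"
    using eventually_gt_at_top[of 0]
  proof eventually_elim
    case (elim n)
    have "norm z ^ n * (real n + a) powr (- Re s) \<le> 1 * real n powr (- Re s)"
      using a z s elim by (intro mult_mono power_le_one powr_mono2') auto
    then show ?case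
      using a by (simp add: norm_mult norm_power norm_of_real_powr del: of_real_add)
  qed
qed

lemma lerch_series_eq:
  "lerch_series s a z = (\<Sum>n. z ^ n * complex_of_real (real n + a) powr (-s))"
  by (simp add: lerch_series_def powr_minus_divide)

lemma lerch_series_sums:
  assumes "0 < a" and "norm z \<le> 1" and "1 < Re s"
  shows "(\<lambda>n. z ^ n * complex_of_real (real n + a) powr (-s)) sums lerch_series s a z"
  using lerch_terms_summable[OF assms] by (simp add: lerch_series_eq summable_sums)

text \<open>
  Near a point \<open>s\<close> the summands are bounded by a constant times \<open>n\<close> to the power \<open>- 1 - d\<close> with
  \<open>d > 0\<close>, uniformly in \<open>s\<close> and for all \<open>z\<close> in the closed unit disc; the Weierstrass M-test does the
  rest.
\<close>
lemma
  assumes a: "0 < a" and z: "norm z \<le> 1"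
  shows remainder_series_sums: "- real k < Re s \<Longrightarrow>
          (\<lambda>n. z ^ n * binomial_remainder k s (real n + a)) sums remainder_series a z k s"
    and holomorphic_on_remainder_series: "remainder_series a z k holomorphic_on {s. - real k < Re s}"
proof -
  let ?S = "{s. - real k < Re s}"
  let ?f = "\<lambda>n s. z ^ n * binomial_remainder k s (real n + a)"
  have S: "open ?S" by (rule open_halfspace_Re_gt)
  have "?f n holomorphic_on UNIV" for n
    using a unfolding binomial_remainder_def gbinomial_prod_rev
    by (intro holomorphic_intros) auto
  then have diff: "?f n field_differentiable at s" for n s
    by (simp add: holomorphic_on_def)
  have "\<exists>g. \<forall>s\<in>?S. (\<lambda>n. ?f n s) sums g s \<and> g field_differentiable at s"
  proof (rule series_differentiable_comparison_complex[OF S diff])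
    fix s assume s: "s \<in> ?S"
    \<comment> \<open>Half the distance to the boundary line: on the disc of radius \<open>d\<close> the exponent keeps a margin \<open>d\<close> below \<open>- 1\<close>.\<close>
    define d where "d = (Re s + real k) / 2"
    have d: "0 < d" using s by (simp add: d_def)
    let ?P = "\<lambda>y. norm (\<Prod>j\<le>k. - y - of_nat j :: complex) / fact k"
    have "compact (?P ` cball s d)"
      by (intro compact_continuous_image continuous_intros) auto
    then obtain B where B: "\<And>y. y \<in> cball s d \<Longrightarrow> ?P y \<le> B"
      by (meson bdd_above_def bdd_above.unfold bounded_imp_bdd_above compact_imp_bounded imageI)
    have B0: "0 \<le> B" using B[of s] d by (meson centre_in_cball divide_nonneg_nonneg fact_ge_zero less_imp_le norm_ge_zero order_trans)
    have bound: "\<forall>\<^sub>F n in sequentially. \<forall>y\<in>ball s d \<inter> ?S. norm (?f n y) \<le> norm (complex_of_real (B * real n powr (- d - 1)))"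
      using eventually_gt_at_top[of 0]
    proof eventually_elim
      case (elim n)
      show ?case
      proof
        fix y assume y: "y \<in> ball s d \<inter> ?S"
        then have "\<bar>Re (s - y)\<bar> < d"
          using abs_Re_le_cmod[of "s - y"] by (simp add: dist_norm)
        then have "Re s - Re y < d" by simp
        then have Re_y: "- Re y - real k - 1 \<le> - d - 1" unfolding d_def by argo
        have "(real n + a) powr (- Re y - real k - 1) \<le> (real n + a) powr (- d - 1)"
          using Re_y elim a by (intro powr_mono) auto
        also have "\<dots> \<le> real n powr (- d - 1)"
          using d elim a by (intro powr_mono2') auto
        finally have *: "(real n + a) powr (- Re y - real k - 1) \<le> real n powr (- d - 1)" .
        have "norm (?f n y) = norm z ^ n * norm (binomial_remainder k y (real n + a))"
          by (simp add: norm_mult norm_power)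
        also have "\<dots> \<le> 1 * (?P y * (real n + a) powr (- Re y - real k - 1))"
          using z a y elim by (intro mult_mono power_le_one norm_binomial_remainder_le) auto
        also have "\<dots> \<le> 1 * (B * real n powr (- d - 1))"
          using y B0 by (intro mult_left_mono mult_mono B *) auto
        also have "\<dots> = norm (complex_of_real (B * real n powr (- d - 1)))"
          unfolding norm_of_real using B0 by simp
        finally show "norm (?f n y) \<le> \<dots>" .
      qed
    qed
    have summ: "summable (\<lambda>n. complex_of_real (B * real n powr (- d - 1)))"
      unfolding summable_complex_of_real using d by (intro summable_mult) (simp add: summable_real_powr_iff)
    have pos: "range (\<lambda>n. complex_of_real (B * real n powr (- d - 1))) \<subseteq> \<real>\<^sub>\<ge>\<^sub>0"
      using B0 by (auto simp del: of_real_mult)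
    show "\<exists>d (h :: nat \<Rightarrow> complex). 0 < d \<and> summable h \<and> range h \<subseteq> \<real>\<^sub>\<ge>\<^sub>0 \<and>
        (\<forall>\<^sub>F n in sequentially. \<forall>y\<in>ball s d \<inter> ?S. norm (?f n y) \<le> norm (h n))"
      by (rule exI[of _ d], rule exI[of _ "\<lambda>n. complex_of_real (B * real n powr (- d - 1))"])
        (intro conjI d summ pos bound)
  qed blast
  then obtain g where g: "\<And>s. s \<in> ?S \<Longrightarrow> (\<lambda>n. ?f n s) sums g s"
      "\<And>s. s \<in> ?S \<Longrightarrow> g field_differentiable at s" by blast
  have eq: "remainder_series a z k s = g s" if "s \<in> ?S" for s
    using g(1)[OF that] by (simp add: remainder_series_def sums_iff)
  show "(\<lambda>n. ?f n s) sums remainder_series a z k s" if "- real k < Re s"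
    using g(1)[of s] eq[of s] that by simp
  have "g holomorphic_on ?S"
    using g(2) by (simp add: holomorphic_on_def field_differentiable_at_within)
  then show "remainder_series a z k holomorphic_on ?S"
    by (rule holomorphic_transform) (simp add: eq)
qed

text \<open>
  Summation by parts, with \<open>(n + 1 + a)\<^sup>-\<^sup>s\<close> expanded around \<open>n + a\<close>. For \<open>z = 1\<close> the term with
  \<open>j = 0\<close>, which would need \<open>Re s > 1\<close> to be summed, cancels. Then \<open>Re s > 0\<close> suffices and the
  left-hand side is zero whatever value its divergent second factor has; this wider range is what
  the continuation of the Hurwitz zeta function requires.
\<close>
lemma lerch_series_shift_identity:
  assumes a: "0 < a" and z: "norm z \<le> 1" and s: "0 < Re s" and "z = 1 \<or> 1 < Re s"
  shows "(1 - z) * lerch_series s a z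
           = of_real a powr (-s)
             + z * ((\<Sum>j=1..k. ((-s) gchoose j) * lerch_series (s + of_nat j) a z)
                    + remainder_series a z k s)"
proof -
  let ?c = "\<lambda>s n. z ^ n * complex_of_real (real n + a) powr (-s)"
  have lim: "?c s \<longlonglongrightarrow> 0"
  proof (rule Lim_null_comparison)
    have "filterlim (\<lambda>n. real n + a) at_top sequentially"
      using filterlim_tendsto_add_at_top[OF tendsto_const filterlim_real_sequentially, of a]
      by (simp add: add.commute)
    then show "(\<lambda>n. (real n + a) powr (- Re s)) \<longlonglongrightarrow> 0"
      using s by (intro tendsto_neg_powr) auto
    show "\<forall>\<^sub>F n in sequentially. norm (?c s n) \<le> (real n + a) powr (- Re s)"
    proof (intro always_eventually allI)
      fix n
      have "norm z ^ n * (real n + a) powr (- Re s) \<le> 1 * (real n + a) powr (- Re s)"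
        using z by (intro mult_right_mono power_le_one) auto
      then show "norm (?c s n) \<le> (real n + a) powr (- Re s)"
        using a by (simp add: norm_mult norm_power norm_of_real_powr del: of_real_add)
    qed
  qed
  have step_eq: "?c s (Suc n) - ?c s n + (1 - z) * ?c s n
      = z * ((\<Sum>j=1..k. ((-s) gchoose j) * ?c (s + of_nat j) n)
             + z ^ n * binomial_remainder k s (real n + a))" for n
    by (simp add: binomial_remainder_def atMost_atLeast0 sum.atLeast_Suc_atMost sum_distrib_left
        algebra_simps)
  have "(\<lambda>n. ?c s (Suc n) - ?c s n) sums (0 - of_real a powr (-s))"
    using telescope_sums[OF lim] by simp
  moreover have "(\<lambda>n. (1 - z) * ?c s n) sums ((1 - z) * lerch_series s a z)"
    using lerch_series_sums[OF a z, of s] assms(4) by (cases "z = 1") (auto intro: sums_mult)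
  ultimately have "(\<lambda>n. ?c s (Suc n) - ?c s n + (1 - z) * ?c s n)
      sums (0 - of_real a powr (-s) + (1 - z) * lerch_series s a z)"
    by (rule sums_add)
  moreover have "(\<lambda>n. z * ((\<Sum>j=1..k. ((-s) gchoose j) * ?c (s + of_nat j) n)
             + z ^ n * binomial_remainder k s (real n + a)))
      sums (z * ((\<Sum>j=1..k. ((-s) gchoose j) * lerch_series (s + of_nat j) a z)
                    + remainder_series a z k s))"
    using s by (intro sums_mult sums_add sums_sum lerch_series_sums remainder_series_sums a z) auto
  ultimately show ?thesis
    unfolding step_eq using sums_unique2 by (fastforce simp: algebra_simps)
qed

section \<open>Analytic continuation by a shift recursion\<close>

text \<open>
  Once \<open>G\<close> is known on \<open>Re s > - m\<close>, the recursion of length \<open>m + 1\<close> defines it on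
  \<open>Re s > - m - 1\<close>, because its right-hand side samples \<open>G\<close> at least one unit to the right and
  \<open>E (m + 1)\<close> is holomorphic there. The extensions to the different half-planes agree by the
  identity theorem, so they glue to an entire function that still satisfies every recursion.
\<close>
lemma shift_recursion_continuation:
  fixes G :: "complex \<Rightarrow> complex" and c E :: "nat \<Rightarrow> complex \<Rightarrow> complex"
  assumes c: "\<And>j. c j holomorphic_on UNIV"
    and E: "\<And>m. E m holomorphic_on {s. - real m < Re s}"
    and G: "\<And>m s. 1 < Re s \<Longrightarrow> G s = (\<Sum>j=1..m. c j s * G (s + of_nat j)) + E m s"
  obtains H where "H holomorphic_on UNIV"
    and "\<And>s. 1 < Re s \<Longrightarrow> H s = G s"
    and "\<And>m s. - real m < Re s \<Longrightarrow> H s = (\<Sum>j=1..m. c j s * H (s + of_nat j)) + E m s"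
proof -
  let ?S = "\<lambda>m::nat. {s. - real m < Re s}"
  have unique: "f s = g s"
    if "f holomorphic_on ?S m" "g holomorphic_on ?S m" "\<And>s. 1 < Re s \<Longrightarrow> f s = g s" "s \<in> ?S m" for f g m s
  proof (rule analytic_continuation_open[OF _ _ _ _ _ that(1,2) _ that(4)])
    show "open {s. 1 < Re s}" "open (?S m)" by (rule open_halfspace_Re_gt)+
    show "connected (?S m)" by (intro convex_connected convex_halfspace_Re_gt)
    have "2 \<in> {s. 1 < Re s}" by simp
    then show "{s. 1 < Re s} \<noteq> {}" by blast
  qed (use that(3) in auto)
  have hol: "(\<lambda>s. (\<Sum>j=1..k. c j s * f (s + of_nat j)) + E k s) holomorphic_on ?S k"
    if f: "f holomorphic_on ?S m" and "k \<le> Suc m" for m k f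
  proof (intro holomorphic_intros E)
    fix j assume j: "j \<in> {1..k}"
    show "c j holomorphic_on ?S k" by (rule holomorphic_on_subset[OF c]) simp
    have "f \<circ> (\<lambda>s. s + of_nat j) holomorphic_on ?S k"
      by (rule holomorphic_on_compose_gen[OF _ f]) (use j \<open>k \<le> Suc m\<close> in \<open>auto intro!: holomorphic_intros\<close>)
    then show "(\<lambda>s. f (s + of_nat j)) holomorphic_on ?S k" by (simp add: o_def)
  qed
  have "\<exists>h. h holomorphic_on ?S m \<and> (\<forall>s. 1 < Re s \<longrightarrow> h s = G s)" for m
  proof (induction m)
    case 0
    show ?case using E[of 0] G[of _ 0] by (intro exI[of _ "E 0"]) auto
  next
    case (Suc m)
    then obtain h where h: "h holomorphic_on ?S m" "\<And>s. 1 < Re s \<Longrightarrow> h s = G s" by blast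
    show ?case
    proof (intro exI conjI allI impI)
      show "(\<lambda>s. (\<Sum>j=1..Suc m. c j s * h (s + of_nat j)) + E (Suc m) s) holomorphic_on ?S (Suc m)"
        by (rule hol[OF h(1)]) simp
      fix s :: complex assume "1 < Re s"
      then show "(\<Sum>j=1..Suc m. c j s * h (s + of_nat j)) + E (Suc m) s = G s"
        using h(2) G[of s "Suc m"] by simp
    qed
  qed
  then obtain h where h: "\<And>m. h m holomorphic_on ?S m" "\<And>m s. 1 < Re s \<Longrightarrow> h m s = G s"
    by metis
  define H where "H s = h (nat \<lceil>\<bar>Re s\<bar>\<rceil> + 1) s" for s
  have H_eq: "H s = h m s" if "s \<in> ?S m" for m s
  proof -
    define n where "n = nat \<lceil>\<bar>Re s\<bar>\<rceil> + 1"
    have "s \<in> ?S (min m n)" using that by (auto simp: min_def n_def) linarith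
    moreover have "?S (min m n) \<subseteq> ?S m" "?S (min m n) \<subseteq> ?S n"
      by (intro Collect_mono impI; simp)+
    then have "h n holomorphic_on ?S (min m n)" "h m holomorphic_on ?S (min m n)"
      using h(1) holomorphic_on_subset by blast+
    ultimately show ?thesis
      unfolding H_def n_def[symmetric] by (intro unique[of "h n" "min m n" "h m" s]) (simp_all add: h(2))
  qed
  have H_hol: "H holomorphic_on ?S m" for m
    by (rule holomorphic_transform[OF h(1)]) (simp add: H_eq)
  have "\<exists>m. s \<in> ?S m" for s
    by (rule exI[of _ "nat \<lceil>\<bar>Re s\<bar>\<rceil> + 1"]) (simp, linarith)
  then have "(\<Union>m. ?S m) = UNIV" by blast
  moreover have "H holomorphic_on (\<Union>m. ?S m)"
    by (intro holomorphic_on_UN_open H_hol open_halfspace_Re_gt)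
  ultimately have "H holomorphic_on UNIV" by simp
  moreover have HG: "H s = G s" if "1 < Re s" for s
    using H_eq[of s 0] h(2) that by simp
  moreover have "H s = (\<Sum>j=1..m. c j s * H (s + of_nat j)) + E m s" if "- real m < Re s" for m s
  proof (rule unique[where m = m and f = H and s = s])
    show "(\<lambda>s. (\<Sum>j=1..m. c j s * H (s + of_nat j)) + E m s) holomorphic_on ?S m"
      by (rule hol[OF H_hol[of m]]) simp
    show "H w = (\<Sum>j=1..m. c j w * H (w + of_nat j)) + E m w" if "1 < Re w" for w
      using G[OF that, of m] that by (simp add: HG)
  qed (use that H_hol in auto)
  ultimately show ?thesis using that by blast
qed

text \<open>
  The last property is the recursion of length 0. It is the one that determines the sign on the
  positive real axis.
\<close>
lemma lerch_entire_extension: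
  assumes a: "0 < a" and z: "norm z \<le> 1" "z \<noteq> 1"
  obtains H where "H holomorphic_on UNIV"
    and "\<And>s. 1 < Re s \<Longrightarrow> H s = lerch_series s a z"
    and "\<And>s. 0 < Re s \<Longrightarrow> (1 - z) * H s = of_real a powr (-s) + z * remainder_series a z 0 s"
proof (rule shift_recursion_continuation)
  define c where "c j s = z * ((-s) gchoose j) / (1 - z)" for j and s :: complex
  define E where "E m s = (of_real a powr (-s) + z * remainder_series a z m s) / (1 - z)" for m s
  show "c j holomorphic_on UNIV" for j
    unfolding c_def[abs_def] gbinomial_prod_rev using z by (intro holomorphic_intros) auto
  show "E m holomorphic_on {s. - real m < Re s}" for m
    unfolding E_def[abs_def] using a z
    by (intro holomorphic_intros holomorphic_on_remainder_series) auto
  show "lerch_series s a z = (\<Sum>j=1..m. c j s * lerch_series (s + of_nat j) a z) + E m s"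
    if "1 < Re s" for m s
  proof -
    define X where "X = (\<Sum>j=1..m. ((-s) gchoose j) * lerch_series (s + of_nat j) a z)"
    have sum_eq: "(\<Sum>j=1..m. c j s * lerch_series (s + of_nat j) a z) = z * X / (1 - z)"
      by (simp add: X_def c_def sum_distrib_left sum_divide_distrib mult_ac)
    have "(1 - z) * lerch_series s a z = of_real a powr (-s) + z * (X + remainder_series a z m s)"
      unfolding X_def using a z(1) that by (intro lerch_series_shift_identity) auto
    then have "lerch_series s a z = (of_real a powr (-s) + z * (X + remainder_series a z m s)) / (1 - z)"
      using z(2) by (simp add: eq_divide_eq mult.commute)
    then show ?thesis
      unfolding sum_eq E_def add_divide_distrib[symmetric] by (simp add: algebra_simps)
  qed
  fix H
  assume H: "H holomorphic_on UNIV" "\<And>s. 1 < Re s \<Longrightarrow> H s = lerch_series s a z"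
    "\<And>m s. - real m < Re s \<Longrightarrow> H s = (\<Sum>j=1..m. c j s * H (s + of_nat j)) + E m s"
  have "(1 - z) * H s = of_real a powr (-s) + z * remainder_series a z 0 s" if "0 < Re s" for s
    using H(3)[of 0 s] that z(2) by (simp add: E_def)
  with H that show thesis by blast
qed

text \<open>
  The shift identity is used at \<open>s - 1\<close>, where its sum starts with \<open>(1 - s) \<zeta>(s, a)\<close>; this term
  becomes the new left-hand side \<open>H(s)\<close>. The other zeta values occur at \<open>s + j\<close> with coefficient
  \<open>(1 - s) gchoose (j + 1)\<close>, which contains, up to sign, the factor \<open>s + j - 1\<close> that turns
  \<open>\<zeta>(s + j, a)\<close> into \<open>H(s + j)\<close>, so no poles arise. The last two properties are the recursions of length
  0 and 1; the second is kept because it still holds at \<open>s = 0\<close>.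
\<close>
lemma hurwitz_entire_extension:
  assumes a: "0 < a"
  obtains H where "H holomorphic_on UNIV"
    and "\<And>s. 1 < Re s \<Longrightarrow> H s = (s - 1) * lerch_series s a 1"
    and "\<And>s. 0 < Re s \<Longrightarrow> H s = of_real a powr (1 - s) + remainder_series a 1 1 (s - 1)"
    and "\<And>s. -1 < Re s \<Longrightarrow>
           H s = of_real a powr (1 - s) - (1 - s) / 2 * H (s + 1) + remainder_series a 1 2 (s - 1)"
proof (rule shift_recursion_continuation)
  define c where "c j s = - ((1 - s) gchoose j) / of_nat (Suc j)" for j and s :: complex
  define E where "E m s = of_real a powr (1 - s) + remainder_series a 1 (Suc m) (s - 1)" for m s
  show "c j holomorphic_on UNIV" for j
    unfolding c_def[abs_def] gbinomial_prod_rev by (intro holomorphic_intros) auto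
  show "E m holomorphic_on {s. - real m < Re s}" for m
  proof -
    have "remainder_series a 1 (Suc m) \<circ> (\<lambda>s. s - 1) holomorphic_on {s. - real m < Re s}"
      by (rule holomorphic_on_compose_gen[OF _ holomorphic_on_remainder_series])
        (use a in \<open>auto intro!: holomorphic_intros\<close>)
    then show ?thesis
      unfolding E_def[abs_def] using a by (intro holomorphic_intros) (auto simp: o_def)
  qed
  show "(s - 1) * lerch_series s a 1
      = (\<Sum>j=1..m. c j s * ((s + of_nat j - 1) * lerch_series (s + of_nat j) a 1)) + E m s"
    if "1 < Re s" for m s
  proof -
    have absorb: "((1 - s) gchoose Suc j) = c j s * (s + of_nat j - 1)" for j
    proof -
      have "of_nat (Suc j) * ((1 - s) gchoose Suc j) = (1 - s - of_nat j) * ((1 - s) gchoose j)"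
        using gbinomial_mult_1[of "1 - s" j] by (simp add: algebra_simps)
      moreover have "of_nat (Suc j) \<noteq> (0 :: complex)" by (rule of_nat_neq_0)
      ultimately show ?thesis unfolding c_def
        by (simp add: field_simps del: of_nat_Suc)
    qed
    define X where "X = (\<Sum>j=1..m. c j s * ((s + of_nat j - 1) * lerch_series (s + of_nat j) a 1))"
    have "(\<Sum>j=1..Suc m. ((1 - s) gchoose j) * lerch_series (s - 1 + of_nat j) a 1)
        = (1 - s) * lerch_series s a 1
          + (\<Sum>j=1..m. ((1 - s) gchoose Suc j) * lerch_series (s - 1 + of_nat (Suc j)) a 1)"
      unfolding One_nat_def sum.atLeast_Suc_atMost[of "Suc 0" "Suc m", simplified]
        sum.shift_bounds_cl_Suc_ivl by (simp add: sum.atLeast_Suc_atMost[of 0 m])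
    also have "\<dots> = (1 - s) * lerch_series s a 1 + X"
      by (simp add: X_def absorb mult.assoc)
    finally have sum_eq: "(\<Sum>j=1..Suc m. ((1 - s) gchoose j) * lerch_series (s - 1 + of_nat j) a 1)
        = (1 - s) * lerch_series s a 1 + X" .
    have "(1 - 1) * lerch_series (s - 1) a 1
        = of_real a powr (- (s - 1)) + 1 * ((\<Sum>j=1..Suc m. ((- (s - 1)) gchoose j) * lerch_series (s - 1 + of_nat j) a 1)
            + remainder_series a 1 (Suc m) (s - 1))"
      using that by (intro lerch_series_shift_identity a) auto
    then have "of_real a powr (1 - s) + ((1 - s) * lerch_series s a 1 + X
        + remainder_series a 1 (Suc m) (s - 1)) = 0"
      unfolding minus_diff_eq sum_eq by simp
    then show ?thesis
      unfolding X_def[symmetric] E_def by (simp add: algebra_simps add_eq_0_iff)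
  qed
  fix H
  assume H: "H holomorphic_on UNIV" "\<And>s. 1 < Re s \<Longrightarrow> H s = (s - 1) * lerch_series s a 1"
    "\<And>m s. - real m < Re s \<Longrightarrow> H s = (\<Sum>j=1..m. c j s * H (s + of_nat j)) + E m s"
  have "H s = of_real a powr (1 - s) + remainder_series a 1 1 (s - 1)" if "0 < Re s" for s
    using H(3)[of 0 s] that by (simp add: E_def)
  moreover have "H s = of_real a powr (1 - s) - (1 - s) / 2 * H (s + 1) + remainder_series a 1 2 (s - 1)"
    if "-1 < Re s" for s
    using H(3)[of 1 s] that by (simp add: E_def c_def numeral_2_eq_2) (simp add: algebra_simps)
  ultimately show thesis using that H by blast
qed

text \<open>
  The choice in \<^const>\<open>hurwitz_lerch\<close> is harmless once some continuation exists, because all of them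
  agree on the domain.
\<close>
lemma hurwitz_lerch_eq:
  assumes "lerch_continuation F a z" and "s \<in> lerch_domain z"
  shows "hurwitz_lerch s a z = F s"
  using assms lerch_continuation_unique someI[of "\<lambda>F. lerch_continuation F a z" F]
  unfolding hurwitz_lerch_def by blast

section \<open>No real zeros away from \<open>z = 1\<close>\<close>

text \<open>
  Each term is a nonnegative number times \<open>1 - z\<^sup>n\<^sup>+\<^sup>1\<close>, which has nonnegative real part in the closed
  unit disc; at \<open>n = 0\<close> both factors contribute strictly.
\<close>
lemma Re_abel_sum_pos:
  fixes c :: "nat \<Rightarrow> real" and z :: complex
  assumes c: "decseq c" "c 1 < c 0" and z: "norm z \<le> 1" "z \<noteq> 1"
    and S: "(\<lambda>n. of_real (c n - c (Suc n)) * (1 - z ^ Suc n)) sums S"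
  shows "0 < Re S"
proof -
  let ?t = "\<lambda>n. (c n - c (Suc n)) * (1 - Re (z ^ Suc n))"
  have t: "?t sums Re S" using sums_Re[OF S] by simp
  have "Re (z ^ Suc n) \<le> 1" for n
    using complex_Re_le_cmod[of "z ^ Suc n"] power_le_one[OF norm_ge_zero z(1), of "Suc n"]
    by (simp only: norm_power)
  then have nonneg: "0 \<le> ?t n" for n
    using decseq_SucD[OF c(1), of n] by simp
  have "Re z \<noteq> 1"
  proof
    assume 1: "Re z = 1"
    then have "(Im z)\<^sup>2 \<le> 0" using z(1) abs_square_le_1[of "norm z"] by (simp add: cmod_power2)
    with 1 z(2) show False by (simp add: complex_eq_iff)
  qed
  then have "0 < ?t 0" using c(2) z(1) complex_Re_le_cmod[of z] by simp
  then show ?thesis using t nonneg suminf_pos2[of ?t 0] by (simp only: sums_iff)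
qed

lemma lerch_nonzero_of_real:
  assumes a: "0 < a" and z: "norm z \<le> 1" "z \<noteq> 1" and \<sigma>: "0 < \<sigma>"
  shows "hurwitz_lerch (of_real \<sigma>) a z \<noteq> 0"
proof -
  obtain H where H: "H holomorphic_on UNIV" "\<And>s. 1 < Re s \<Longrightarrow> H s = lerch_series s a z"
    "\<And>s. 0 < Re s \<Longrightarrow> (1 - z) * H s = of_real a powr (-s) + z * remainder_series a z 0 s"
    by (rule lerch_entire_extension[OF a z]) blast
  define c where "c n = (real n + a) powr (- \<sigma>)" for n
  have anti: "c m \<le> c n" if "n \<le> m" for m n
    unfolding c_def using a \<sigma> that by (intro powr_mono2') auto
  have c10: "c 1 < c 0"
    unfolding c_def using a \<sigma> by (intro powr_less_mono2_neg) auto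
  have lim: "c \<longlonglongrightarrow> 0"
    unfolding c_def using \<sigma> filterlim_tendsto_add_at_top[OF tendsto_const filterlim_real_sequentially, of a]
    by (intro tendsto_neg_powr) (auto simp: add.commute)
  have rem: "binomial_remainder 0 (of_real \<sigma>) (real n + a) = of_real (c (Suc n) - c n)" for n
    using a powr_of_real[of "real n + a" "- \<sigma>"] powr_of_real[of "real n + a + 1" "- \<sigma>"]
    by (simp add: binomial_remainder_def c_def add_ac)
  have "(\<lambda>n. complex_of_real (c n - c (Suc n)) + z * (z ^ n * of_real (c (Suc n) - c n)))
      sums (of_real (c 0 - 0) + z * remainder_series a z 0 (of_real \<sigma>))"
  proof (intro sums_add sums_mult)
    show "(\<lambda>n. complex_of_real (c n - c (Suc n))) sums of_real (c 0 - 0)"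
      unfolding sums_of_real_iff by (rule telescope_sums'[OF lim])
    show "(\<lambda>n. z ^ n * of_real (c (Suc n) - c n)) sums remainder_series a z 0 (of_real \<sigma>)"
      using remainder_series_sums[OF a z(1), of 0 "of_real \<sigma>"] \<sigma> unfolding rem by simp
  qed
  also have "of_real (c 0 - 0) + z * remainder_series a z 0 (of_real \<sigma>) = (1 - z) * H (of_real \<sigma>)"
    using H(3)[of "of_real \<sigma>"] \<sigma> a powr_of_real[of a "- \<sigma>"] by (simp add: c_def)
  also have "(\<lambda>n. complex_of_real (c n - c (Suc n)) + z * (z ^ n * of_real (c (Suc n) - c n)))
      = (\<lambda>n. of_real (c n - c (Suc n)) * (1 - z ^ Suc n))"
    by (simp add: fun_eq_iff algebra_simps)
  finally have "0 < Re ((1 - z) * H (of_real \<sigma>))"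
    by (intro Re_abel_sum_pos[OF _ c10 z]) (auto simp: antimono_def anti)
  moreover have "lerch_continuation H a z"
    using H z by (simp add: lerch_continuation_def lerch_domain_def)
  ultimately show ?thesis
    using hurwitz_lerch_eq[of H a z "of_real \<sigma>"] z(2) by (auto simp: lerch_domain_def)
qed

lemma hurwitz_lerch_one_eq:
  assumes "H holomorphic_on UNIV" and "\<And>s. 1 < Re s \<Longrightarrow> H s = (s - 1) * lerch_series s a 1"
    and "s \<noteq> 1"
  shows "hurwitz_lerch s a 1 = H s / (s - 1)"
proof (rule hurwitz_lerch_eq)
  show "lerch_continuation (\<lambda>s. H s / (s - 1)) a 1"
    unfolding lerch_continuation_def lerch_domain_def using assms(2)
    by (auto intro!: holomorphic_intros holomorphic_on_subset[OF assms(1)])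
qed (use assms in \<open>simp add: lerch_domain_def\<close>)

section \<open>The Hurwitz zeta function on the unit interval\<close>

text \<open>
  The real form of the binomial remainder of order 1 at \<open>s = - p\<close>, which is the error of the tangent
  to \<open>y \<mapsto> y\<^sup>p\<close> at \<open>x\<close>.
\<close>
definition powr_tangent_error :: "real \<Rightarrow> real \<Rightarrow> real" where
  "powr_tangent_error p x = (x + 1) powr p - x powr p - p * x powr (p - 1)"

lemma powr_tangent_error_sums:
  assumes a: "0 < a" and p: "p < 1"
  shows "summable (\<lambda>n. powr_tangent_error p (real n + a))"
    and "remainder_series a 1 1 (- of_real p) = of_real (\<Sum>n. powr_tangent_error p (real n + a))"
proof -
  have eq: "binomial_remainder 1 (- of_real p) (real n + a) = of_real (powr_tangent_error p (real n + a))" for n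
    using a powr_of_real[of "real n + a" p] powr_of_real[of "real n + a + 1" p]
      powr_of_real[of "real n + a" "p - 1"]
    by (simp add: binomial_remainder_def powr_tangent_error_def add_ac algebra_simps)
  have "(\<lambda>n. complex_of_real (powr_tangent_error p (real n + a))) sums remainder_series a 1 1 (- of_real p)"
    using remainder_series_sums[OF a, of 1 1 "- of_real p"] p by (simp add: eq[symmetric])
  then show "summable (\<lambda>n. powr_tangent_error p (real n + a))"
    and "remainder_series a 1 1 (- of_real p) = of_real (\<Sum>n. powr_tangent_error p (real n + a))"
    by (auto simp: sums_iff suminf_of_real)
qed

text \<open>
  The central difference is the average of the derivative of \<open>y \<mapsto> y\<^sup>p\<close> over the unit interval centred
  at \<open>x\<close>, and that derivative is strictly convex. The proof lets the interval grow from its centre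
  with half-width \<open>h\<close>; convexity, in the form of the inequality of arithmetic and geometric means,
  makes the difference of the two sides increase in \<open>h\<close>.
\<close>
lemma powr_derivative_less_central_difference:
  fixes x p :: real
  assumes p: "0 < p" "p < 1" and x: "1 / 2 \<le> x"
  shows "p * x powr (p - 1) < (x + 1 / 2) powr p - (x - 1 / 2) powr p"
proof -
  define f where "f h = (x + h) powr p - (x - h) powr p - 2 * h * (p * x powr (p - 1))" for h
  have "f 0 < f (1 / 2)"
  proof (rule DERIV_pos_imp_increasing_open[where f = f])
    show "continuous_on {0..1 / 2} f"
      unfolding f_def[abs_def] using x p
      by (intro continuous_on_diff continuous_on_powr' continuous_on_mult continuous_on_add continuous_on_const continuous_on_id) auto
    fix h :: real assume h: "0 < h" "h < 1 / 2"
    define u v where "u = (x + h) powr ((p - 1) / 2)" and "v = (x - h) powr ((p - 1) / 2)"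
    have sq: "(x + h) powr (p - 1) = u\<^sup>2" "(x - h) powr (p - 1) = v\<^sup>2"
      using h x by (simp_all add: u_def v_def power2_eq_square flip: powr_add)
    have "x powr (p - 1) = (x * x) powr ((p - 1) / 2)"
      using x by (simp add: powr_mult flip: powr_add)
    also have "\<dots> < ((x + h) * (x - h)) powr ((p - 1) / 2)"
      using h x p mult_strict_mono[of h x h x] by (intro powr_less_mono2_neg) (auto simp: algebra_simps)
    also have "\<dots> = u * v" using h x by (simp add: u_def v_def powr_mult)
    finally have "2 * x powr (p - 1) < u\<^sup>2 + v\<^sup>2"
      using sum_squares_bound[of u v] by simp
    then have "0 < p * (u\<^sup>2 + v\<^sup>2 - 2 * x powr (p - 1))" using p by simp
    moreover have "(f has_real_derivative
        p * ((x + h) powr (p - 1) + (x - h) powr (p - 1) - 2 * x powr (p - 1))) (at h)"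
      unfolding f_def[abs_def] using h x
      by (auto intro!: derivative_eq_intros simp: algebra_simps)
    ultimately show "\<exists>y. (f has_real_derivative y) (at h) \<and> 0 < y"
      unfolding sq by blast
  qed simp
  then show ?thesis by (simp add: f_def)
qed

text \<open>
  Write \<open>f(x) = x\<^sup>p\<close>. Replacing \<open>f'(n + a)\<close> by the larger central difference costs \<open>\<delta> n > 0\<close> and
  leaves increments of \<open>g n = f(n + a) - f(n + a - 1/2) \<ge> 0\<close>, so that the sum is at least
  \<open>\<delta> 0 - g 0 > - f(a)\<close>.
\<close>
lemma powr_plus_tangent_error_sum_pos:
  assumes a: "1 / 2 \<le> a" and p: "0 < p" "p < 1"
  shows "0 < a powr p + (\<Sum>n. powr_tangent_error p (real n + a))"
proof -
  let ?t = "\<lambda>n. powr_tangent_error p (real n + a)"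
  define g where "g n = (real n + a) powr p - (real n + a - 1 / 2) powr p" for n
  define \<delta> where "\<delta> n = (real n + a + 1 / 2) powr p - (real n + a - 1 / 2) powr p
                        - p * (real n + a) powr (p - 1)" for n
  have \<delta>: "0 < \<delta> n" for n
    using powr_derivative_less_central_difference[OF p, of "real n + a"] a by (simp add: \<delta>_def)
  have t: "?t n = (g (Suc n) - g n) + \<delta> n" for n
    by (simp add: powr_tangent_error_def g_def \<delta>_def algebra_simps)
  have g: "0 \<le> g n" for n
    unfolding g_def using p a by (simp add: powr_mono2)
  have "- g 0 + \<delta> 0 \<le> (\<Sum>n<N. ?t n)" if "1 \<le> N" for N
  proof -
    have "\<delta> 0 \<le> (\<Sum>n<N. \<delta> n)"
      using that \<delta> by (intro member_le_sum) (auto intro: less_imp_le)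
    then show ?thesis
      using g[of N] by (simp add: t sum.distrib sum_lessThan_telescope)
  qed
  moreover have "(\<lambda>N. \<Sum>n<N. ?t n) \<longlonglongrightarrow> suminf ?t"
    using powr_tangent_error_sums(1)[of a p] a p by (intro summable_LIMSEQ) auto
  ultimately have "- g 0 + \<delta> 0 \<le> suminf ?t" by (intro LIMSEQ_le_const) blast+
  moreover have "g 0 \<le> a powr p" by (simp add: g_def)
  ultimately show ?thesis using \<delta>[of 0] by linarith
qed

lemma hurwitz_nonzero_of_real:
  assumes a: "1 / 2 \<le> a" and \<sigma>: "0 < \<sigma>" "\<sigma> < 1"
  shows "hurwitz_lerch (of_real \<sigma>) a 1 \<noteq> 0"
proof -
  have a0: "0 < a" using a by simp
  obtain H where H: "H holomorphic_on UNIV" "\<And>s. 1 < Re s \<Longrightarrow> H s = (s - 1) * lerch_series s a 1"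
    "\<And>s. 0 < Re s \<Longrightarrow> H s = of_real a powr (1 - s) + remainder_series a 1 1 (s - 1)"
    by (rule hurwitz_entire_extension[OF a0]) blast
  have "H (of_real \<sigma>) = of_real (a powr (1 - \<sigma>) + (\<Sum>n. powr_tangent_error (1 - \<sigma>) (real n + a)))"
    using H(3)[of "of_real \<sigma>"] powr_tangent_error_sums(2)[OF a0, of "1 - \<sigma>"] \<sigma> a0
      powr_of_real[of a "1 - \<sigma>"] by simp
  then have "H (of_real \<sigma>) \<noteq> 0"
    using powr_plus_tangent_error_sum_pos[OF a, of "1 - \<sigma>"] \<sigma> by (simp del: of_real_add)
  then show ?thesis
    using hurwitz_lerch_one_eq[OF H(1,2), of "of_real \<sigma>"] \<sigma> by simp
qed

text \<open>
  \<open>H(s) = (s - 1) \<zeta>(s, a)\<close> changes sign between 0 and 1. At both ends the error series vanishes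
  termwise: at \<open>s = 1\<close> and \<open>s = 0\<close> the function being expanded is \<open>x\<^sup>0\<close> and \<open>x\<^sup>1\<close>, a polynomial of
  degree at most the order of the expansion.
\<close>
lemma hurwitz_has_real_zero:
  assumes a: "0 < a" "a < 1 / 2"
  obtains \<sigma> where "0 < \<sigma>" "\<sigma> < 1" "hurwitz_lerch (of_real \<sigma>) a 1 = 0"
proof -
  obtain H where H: "H holomorphic_on UNIV" "\<And>s. 1 < Re s \<Longrightarrow> H s = (s - 1) * lerch_series s a 1"
    "\<And>s. 0 < Re s \<Longrightarrow> H s = of_real a powr (1 - s) + remainder_series a 1 1 (s - 1)"
    "\<And>s. -1 < Re s \<Longrightarrow>
       H s = of_real a powr (1 - s) - (1 - s) / 2 * H (s + 1) + remainder_series a 1 2 (s - 1)"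
    by (rule hurwitz_entire_extension[OF a(1)]) blast
  have nz: "complex_of_real (real n + a) \<noteq> 0" "complex_of_real (real n + a + 1) \<noteq> 0" for n
    using a by (auto simp del: of_real_add)
  have "binomial_remainder 1 0 (real n + a) = 0" for n
    using nz[of n] by (simp add: binomial_remainder_def del: of_real_add)
  then have "H 1 = 1"
    using H(3)[of 1] a by (simp add: remainder_series_def)
  moreover have "binomial_remainder 2 (-1) (real n + a) = 0" for n
    using nz[of n] by (simp add: binomial_remainder_def numeral_2_eq_2 gbinomial_Suc del: of_real_add) simp
  then have "H 0 = of_real a - 1 / 2 * H 1"
    using H(4)[of 0] a by (simp add: remainder_series_def)
  ultimately have ends: "Re (H 0) = a - 1 / 2" "Re (H 1) = 1" by simp_all
  have "continuous_on {0..1::real} (\<lambda>\<sigma>. H (of_real \<sigma>))"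
    by (rule continuous_on_compose2[OF holomorphic_on_imp_continuous_on[OF H(1)]])
      (auto intro: continuous_intros)
  then have "continuous_on {0..1} (\<lambda>\<sigma>. Re (H (of_real \<sigma>)))"
    by (rule continuous_on_Re)
  then obtain \<sigma> where \<sigma>: "0 \<le> \<sigma>" "\<sigma> \<le> 1" "Re (H (of_real \<sigma>)) = 0"
    using IVT'[of "\<lambda>\<sigma>. Re (H (of_real \<sigma>))" 0 0 1] ends a by auto
  have "\<sigma> \<noteq> 0" "\<sigma> \<noteq> 1" using \<sigma> ends a by auto
  then have \<sigma>': "0 < \<sigma>" "\<sigma> < 1" using \<sigma> by auto
  have "H (of_real \<sigma>) = of_real (a powr (1 - \<sigma>) + (\<Sum>n. powr_tangent_error (1 - \<sigma>) (real n + a)))"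
    using H(3)[of "of_real \<sigma>"] powr_tangent_error_sums(2)[OF a(1), of "1 - \<sigma>"] \<sigma>' a
      powr_of_real[of a "1 - \<sigma>"] by simp
  then have "H (of_real \<sigma>) = 0" using \<sigma>(3) by (simp add: complex_eq_iff)
  then have "hurwitz_lerch (of_real \<sigma>) a 1 = 0"
    using hurwitz_lerch_one_eq[OF H(1,2), of "of_real \<sigma>"] \<sigma>' by simp
  with \<sigma>' that show thesis by blast
qed

theorem theorem1p2:
  fixes a :: real and z :: complex
  assumes "0 < a" and "a \<le> 1" and "0 < norm z" and "norm z \<le> 1"
  shows "(z = 1 \<longrightarrow>
            ((\<forall>\<sigma>::real. 0 < \<sigma> \<and> \<sigma> < 1 \<longrightarrow> hurwitz_lerch (of_real \<sigma>) a z \<noteq> 0)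
              \<longleftrightarrow> a \<ge> 1 / 2)) \<and>
         (z \<noteq> 1 \<longrightarrow>
            (\<forall>\<sigma>::real. 0 < \<sigma> \<and> \<sigma> < 1 \<longrightarrow> hurwitz_lerch (of_real \<sigma>) a z \<noteq> 0))"
proof (intro conjI impI)
  assume "z = 1"
  moreover have "1 / 2 \<le> a" if "\<forall>\<sigma>::real. 0 < \<sigma> \<and> \<sigma> < 1 \<longrightarrow> hurwitz_lerch (of_real \<sigma>) a 1 \<noteq> 0"
    using hurwitz_has_real_zero[OF assms(1)] that by (metis not_le)
  ultimately show "(\<forall>\<sigma>::real. 0 < \<sigma> \<and> \<sigma> < 1 \<longrightarrow> hurwitz_lerch (of_real \<sigma>) a z \<noteq> 0) \<longleftrightarrow> a \<ge> 1 / 2"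
    using hurwitz_nonzero_of_real by blast
next
  assume "z \<noteq> 1"
  then show "\<forall>\<sigma>::real. 0 < \<sigma> \<and> \<sigma> < 1 \<longrightarrow> hurwitz_lerch (of_real \<sigma>) a z \<noteq> 0"
    using lerch_nonzero_of_real assms by blast
qed
end
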